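(* Let $A,B,C,D,E,G\in\mathbb{C}$, let $F$ be a negative integer, and let $\omega\in\mathbb{C}$ satisfy $$ \omega^2=\frac{GBC}{A-B-C-G}+\frac{A^2}{4}. $$ Then $$ {}_{5}F_{4}\left(\begin{matrix} A-B-C,\;D,\;E,\;F,\;G+1 \\ 1+A-B,\;1+A-C,\;D+E+F-A,\;G \end{matrix}\right) =\frac{\Gamma(A+1)\Gamma(1+A-D-F)\Gamma(1+A-E-F)\Gamma(1+A-D-E)}{\Gamma(1+A-F)\Gamma(1+A-D)\Gamma(1+A-E)\Gamma(1+A-D-E-F)} $$ $$ \times\;{}_{9}F_{8}\left(\begin{matrix} A,\;1+A/2,\;B,\;C,\;D,\;E,\;F,\;A/2-\omega+1,\;A/2+\omega+1 \\ A/2,\;1+A-B,\;1+A-C,\;1+A-D,\;1+A-E,\;1+A-F,\;A/2-\omega,\;A/2+\omega \end{matrix}\right). $$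
   Context: ${}_pF_q$ denotes the generalized hypergeometric series evaluated at unit argument. Standing convention: lower parameters are never non-positive integers, denominators occurring do not vanish, and the Gamma functions occurring are not evaluated at poles. *)

theory Defs
  imports "HOL-Analysis.Analysis"
begin

text \<open>
  The value at unit argument of the hypergeometric series with upper parameters \<open>as\<close> and lower
  parameters \<open>bs\<close>. The library's \<open>fps_hypergeo as bs c\<close> is the formal series in \<open>X\<close> whose argument
  is \<open>c * X\<close>, hence the factor \<open>1\<close> twice.
\<close>

definition hypergeo_unit :: "complex list \<Rightarrow> complex list \<Rightarrow> complex" where
  "hypergeo_unit as bs = eval_fps (fps_hypergeo as bs 1) 1"

lemma hypergeo_unit_eq_suminf:
  "hypergeo_unit as bs =
     (\<Sum>k. prod_list (map (\<lambda>a. pochhammer a k) as) /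
          (prod_list (map (\<lambda>b. pochhammer b k) bs) * fact k))"
proof -
  have foldl_eq: "foldl (\<lambda>r a. r * pochhammer a k) c xs =
      c * prod_list (map (\<lambda>a. pochhammer a k) xs)" for k c and xs :: "complex list"
    by (induction xs arbitrary: c) (simp_all add: mult.assoc)
  show ?thesis
    by (simp add: hypergeo_unit_def eval_fps_def foldl_eq)
qed

end

theory Submission
  imports Defs
begin

text \<open>
  Write \<open>F = - n\<close>. Apart from the factor with \<open>\<omega>\<close>, the coefficients of the \<open>\<^sub>9F\<^sub>8\<close> series that do not
  involve \<open>D, E, F\<close> form, against the kernel \<open>1 / ((k - r)! (1 + A)\<^sub>k\<^sub>+\<^sub>r)\<close>, the classical Bailey pair
  behind the summation of a terminating very-well-poised \<open>\<^sub>5F\<^sub>4\<close>. The factor with \<open>\<omega>\<close> equals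
  \<open>1 - r (r + A) X\<close> with \<open>X = (A - B - C - G) / (G B C)\<close>, and since
  \<open>(k - r) (k + r + A) = k (k + A) - r (r + A)\<close>, it turns the pair into one whose second
  member is the combination of two neighbouring terms that produces \<open>A - B - C\<close> and
  \<open>(G + 1)\<^sub>k / (G)\<^sub>k\<close>. Pairing with the sequence built from \<open>D, E, F\<close>
  and summing it by the Pfaff-Saalschuetz theorem gives the transformation.
\<close>

section \<open>Nonvanishing away from the poles, and the Pfaff-Saalschuetz sum\<close>

lemma pochhammer_nonzero:
  fixes z :: "'a :: field_char_0"
  assumes "z \<notin> \<int>\<^sub>\<le>\<^sub>0"
  shows "pochhammer z n \<noteq> 0"
  using assms pochhammer_eq_0_imp_nonpos_Int by blast

lemma add_of_nat_nonzero:
  fixes z :: "'a :: field_char_0"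
  assumes "z \<notin> \<int>\<^sub>\<le>\<^sub>0"
  shows "z + of_nat n \<noteq> 0"
proof
  assume "z + of_nat n = 0"
  then have "z = - of_nat n"
    by (simp only: eq_neg_iff_add_eq_0)
  with assms show False
    by simp
qed

text \<open>
  The quotient of the two Pochhammer symbols involving \<open>n\<close> in the usual form of the theorem is
  written here as a convolution, which needs no assumption on \<open>c - a - b\<close>. The proof telescopes the
  recurrence in \<open>n\<close> (Wilf-Zeilberger method).
\<close>

lemma saalschuetz:
  fixes a b c :: "'a :: field_char_0"
  assumes c: "c \<notin> \<int>\<^sub>\<le>\<^sub>0"
  shows "(\<Sum>j\<le>n. pochhammer a j * pochhammer b j / (fact j * pochhammer c j) *
            (pochhammer (c - a - b) (n - j) / fact (n - j))) =
         pochhammer (c - a) n * pochhammer (c - b) n / (fact n * pochhammer c n)"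
proof (induction n)
  case 0
  show ?case by simp
next
  case (Suc n)
  define s where "s = c - a - b"
  define t where "t = (\<lambda>n j. pochhammer a j * pochhammer b j / (fact j * pochhammer c j) *
    (pochhammer s (n - j) / fact (n - j)))"
  \<comment> \<open>\<open>P / Q\<close> is the quotient of the claimed closed forms at
    \<open>n + 1\<close> and \<open>n\<close>; \<open>g\<close> is the certificate whose differences
    give the recurrence termwise.\<close>
  define P where "P = (c - a + of_nat n) * (c - b + of_nat n)"
  define Q where "Q = (1 + of_nat n) * (c + of_nat n)"
  define g where "g = (\<lambda>j. of_nat j * (c + of_nat j - 1) * t (Suc n) j)"
  have nz: "pochhammer c j \<noteq> 0" "c + of_nat j \<noteq> 0" for j
    using c by (simp_all add: pochhammer_nonzero add_of_nat_nonzero)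
  have step: "Q * t (Suc n) j - P * t n j = g j - g (Suc j)" if "j \<le> n" for j
  proof -
    obtain m where m: "n = j + m"
      using le_Suc_ex[OF \<open>j \<le> n\<close>] by blast
    have nz': "of_nat (Suc m) \<noteq> (0 :: 'a)" "of_nat (Suc j) \<noteq> (0 :: 'a)"
      by (rule of_nat_neq_0)+
    have "t (Suc n) j = t n j * ((s + of_nat m) / of_nat (Suc m))"
      by (simp add: t_def m Suc_diff_le pochhammer_Suc mult_ac del: of_nat_Suc)
    then have t1: "t (Suc n) j * of_nat (Suc m) = t n j * (s + of_nat m)"
      using nz' by (simp del: of_nat_Suc)
    have cj: "c + of_nat (Suc j) - 1 = c + of_nat j"
      by simp
    have g1: "g (Suc j) = t n j * ((a + of_nat j) * (b + of_nat j))"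
      unfolding g_def t_def m pochhammer_Suc fact_Suc cj
      using nz[of j] nz' by (simp add: mult_ac del: of_nat_Suc)
    \<comment> \<open>After multiplication by \<open>m + 1\<close>, where m = n - j, every term is a
      polynomial multiple of \<open>t n j\<close>, so a polynomial identity remains.\<close>
    have "(Q * t (Suc n) j - P * t n j) * of_nat (Suc m) =
        Q * (t (Suc n) j * of_nat (Suc m)) - P * of_nat (Suc m) * t n j"
      by (simp only: left_diff_distrib right_diff_distrib mult_ac)
    also have "\<dots> = (Q * (s + of_nat m) - P * of_nat (Suc m)) * t n j"
      unfolding t1 by (simp only: left_diff_distrib right_diff_distrib mult_ac)
    also have "Q * (s + of_nat m) - P * of_nat (Suc m) =
        of_nat j * (c + of_nat j - 1) * (s + of_nat m) - (a + of_nat j) * (b + of_nat j) * of_nat (Suc m)"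
      by (simp add: Q_def P_def s_def m algebra_simps)
    also have "\<dots> * t n j = of_nat j * (c + of_nat j - 1) * (t (Suc n) j * of_nat (Suc m)) -
        g (Suc j) * of_nat (Suc m)"
      unfolding t1 g1 by (simp only: left_diff_distrib right_diff_distrib mult_ac)
    also have "\<dots> = (g j - g (Suc j)) * of_nat (Suc m)"
      unfolding g_def by (simp only: left_diff_distrib right_diff_distrib mult_ac)
    finally show ?thesis using nz' by (simp del: of_nat_Suc)
  qed
  \<comment> \<open>The index n + 1 is split off because truncated subtraction makes
    \<open>t n (Suc n)\<close> a spurious value. Its contribution equals \<open>g (Suc n)\<close>
    and cancels the end of the telescope; \<open>g 0\<close> vanishes.\<close>
  have "Q * (\<Sum>j\<le>Suc n. t (Suc n) j) - P * (\<Sum>j\<le>n. t n j)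
      = (\<Sum>j\<le>n. Q * t (Suc n) j - P * t n j) + Q * t (Suc n) (Suc n)"
    by (simp add: sum_subtractf sum_distrib_left algebra_simps)
  also have "(\<Sum>j\<le>n. Q * t (Suc n) j - P * t n j) = (\<Sum>j\<le>n. g j - g (Suc j))"
    using step by (intro sum.cong) auto
  also have "\<dots> = - g (Suc n)"
    by (subst sum_telescope) (simp add: g_def)
  also have "\<dots> + Q * t (Suc n) (Suc n) = 0"
    by (simp add: g_def Q_def algebra_simps)
  finally have "Q * (\<Sum>j\<le>Suc n. t (Suc n) j) = P * (\<Sum>j\<le>n. t n j)"
    by simp
  also have "(\<Sum>j\<le>n. t n j) = pochhammer (c - a) n * pochhammer (c - b) n / (fact n * pochhammer c n)"
    using Suc.IH by (simp add: t_def s_def)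
  moreover have "Q \<noteq> 0"
    using nz(2)[of n] of_nat_neq_0[of n, where ?'a = 'a] by (simp add: Q_def)
  ultimately have "(\<Sum>j\<le>Suc n. t (Suc n) j) =
      P * (pochhammer (c - a) n * pochhammer (c - b) n / (fact n * pochhammer c n)) / Q"
    by (simp only: nonzero_eq_divide_eq mult.commute[of _ Q] simp_thms)
  then show ?case
    by (simp add: t_def s_def P_def Q_def pochhammer_Suc mult_ac)
qed

section \<open>The well-poised Bailey pair and its weighted form\<close>

text \<open>The part of the \<open>9F8\<close> term built from A, B, C alone. The factor (A + 2r)/A
  is (1 + A/2)_r / (A/2)_r, and the sign later cancels the one in (F)_r.\<close>

definition well_poised_coeff :: "'a :: field_char_0 \<Rightarrow> 'a \<Rightarrow> 'a \<Rightarrow> nat \<Rightarrow> 'a" where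
  "well_poised_coeff A B C r =
     (-1) ^ r * (A + 2 * of_nat r) / A * pochhammer A r * pochhammer B r * pochhammer C r /
       (fact r * pochhammer (1 + A - B) r * pochhammer (1 + A - C) r)"

text \<open>Up to the factor 1/(k! (1 + A)_k), the left side is the very-well-poised
  \<open>5F4\<close> with upper parameters A, 1 + A/2, B, C, -k. It is summed by a recurrence in k
  with a telescoping certificate.\<close>

lemma well_poised_bailey_pair:
  fixes A B C :: "'a :: field_char_0"
  assumes A: "A \<noteq> 0" "1 + A \<notin> \<int>\<^sub>\<le>\<^sub>0"
    and B: "1 + A - B \<notin> \<int>\<^sub>\<le>\<^sub>0" and C: "1 + A - C \<notin> \<int>\<^sub>\<le>\<^sub>0"
  shows "(\<Sum>r\<le>k. well_poised_coeff A B C r / (fact (k - r) * pochhammer (1 + A) (k + r))) =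
         pochhammer (1 + A - B - C) k /
           (fact k * pochhammer (1 + A - B) k * pochhammer (1 + A - C) k)"
proof (induction k)
  case 0
  show ?case using A by (simp add: well_poised_coeff_def)
next
  case (Suc k)
  \<comment> \<open>Stripping (A + 2r)/A from the summand \<open>t\<close> leaves \<open>v\<close>,
    of which the certificate \<open>g\<close> is a polynomial multiple with only A in the
    denominator.\<close>
  define v where "v = (\<lambda>k r. (-1) ^ r * pochhammer A r * pochhammer B r * pochhammer C r /
    (fact r * pochhammer (1 + A - B) r * pochhammer (1 + A - C) r) /
    (fact (k - r) * pochhammer (1 + A) (k + r)))"
  define t where "t = (\<lambda>k r. (A + 2 * of_nat r) / A * v k r)"
  define P where "P = 1 + A - B - C + of_nat k"
  define Q where "Q = (1 + of_nat k) * (1 + A - B + of_nat k) * (1 + A - C + of_nat k)"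
  define g where "g = (\<lambda>r. of_nat r * (A - B + of_nat r) * (A - C + of_nat r) *
    (1 + A + of_nat (k + r)) * v (Suc k) r / A)"
  have nz: "1 + A + of_nat j \<noteq> 0" "1 + A - B + of_nat j \<noteq> 0" "1 + A - C + of_nat j \<noteq> 0" for j
    using assms by (simp_all add: add_of_nat_nonzero)
  have step: "Q * t (Suc k) r - P * t k r = g r - g (Suc r)" if "r \<le> k" for r
  proof -
    obtain m where m: "k = r + m"
      using le_Suc_ex[OF \<open>r \<le> k\<close>] by blast
    define z where "z = 1 + A + of_nat (k + r)"
    have z: "z \<noteq> 0" using nz(1) unfolding z_def .
    have nz': "of_nat (Suc m) \<noteq> (0 :: 'a)" "of_nat (Suc r) \<noteq> (0 :: 'a)"
      by (rule of_nat_neq_0)+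
    have "v (Suc k) r = v k r / (of_nat (Suc m) * z)"
      by (simp add: v_def m z_def Suc_diff_le pochhammer_Suc mult_ac del: of_nat_Suc of_nat_add)
    then have v1: "v k r = v (Suc k) r * of_nat (Suc m) * z"
      using nz' z by (simp del: of_nat_Suc)
    have "v (Suc k) (Suc r) = - (v (Suc k) r * of_nat (Suc m) * (A + of_nat r) * (B + of_nat r) * (C + of_nat r)) /
        (of_nat (Suc r) * (1 + A - B + of_nat r) * (1 + A - C + of_nat r) * (1 + A + of_nat (k + Suc r)))"
      using nz' by (simp add: v_def m Suc_diff_le pochhammer_Suc mult_ac del: of_nat_Suc of_nat_add)
    then have "v (Suc k) (Suc r) * (of_nat (Suc r) * (1 + A - B + of_nat r) * (1 + A - C + of_nat r) *
       (1 + A + of_nat (k + Suc r))) =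
       - (v (Suc k) r * of_nat (Suc m) * (A + of_nat r) * (B + of_nat r) * (C + of_nat r))"
      using nz(2,3)[of r] nz(1)[of "k + Suc r"] nz' by (simp del: of_nat_Suc of_nat_add)
    moreover have "g (Suc r) * A = v (Suc k) (Suc r) * (of_nat (Suc r) * (1 + A - B + of_nat r) *
       (1 + A - C + of_nat r) * (1 + A + of_nat (k + Suc r)))"
    proof -
      have shift: "A - B + of_nat (Suc r) = 1 + A - B + of_nat r" "A - C + of_nat (Suc r) = 1 + A - C + of_nat r"
        by simp_all
      show ?thesis
        unfolding g_def shift using A(1) by (simp add: mult_ac del: of_nat_Suc of_nat_add)
    qed
    ultimately have gA: "g (Suc r) * A = - (v (Suc k) r * of_nat (Suc m) * (A + of_nat r) * (B + of_nat r) * (C + of_nat r))"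
      "g r * A = of_nat r * (A - B + of_nat r) * (A - C + of_nat r) * z * v (Suc k) r"
      using A(1) by (simp_all add: g_def z_def del: of_nat_Suc of_nat_add)
    have tA: "t k' r * A = (A + 2 * of_nat r) * v k' r" for k'
      using A(1) by (simp add: t_def)
    have "(Q * t (Suc k) r - P * t k r) * A = Q * (t (Suc k) r * A) - P * (t k r * A)"
      by (simp only: left_diff_distrib right_diff_distrib mult_ac)
    also have "\<dots> = (Q - P * of_nat (Suc m) * z) * (A + 2 * of_nat r) * v (Suc k) r"
      unfolding tA v1 by (simp only: left_diff_distrib right_diff_distrib mult_ac)
    \<comment> \<open>Everything has been expressed through \<open>v (Suc k) r\<close>; this
      polynomial identity is what makes \<open>g\<close> a certificate.\<close>
    also have "(Q - P * of_nat (Suc m) * z) * (A + 2 * of_nat r) =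
        of_nat r * (A - B + of_nat r) * (A - C + of_nat r) * z +
        of_nat (Suc m) * (A + of_nat r) * (B + of_nat r) * (C + of_nat r)"
      by (simp add: Q_def P_def z_def m algebra_simps)
    also have "\<dots> * v (Suc k) r = (g r - g (Suc r)) * A"
      unfolding left_diff_distrib gA by (simp add: algebra_simps del: of_nat_Suc)
    finally have "(Q * t (Suc k) r - P * t k r) * A = (g r - g (Suc r)) * A" .
    then show ?thesis using A(1) by simp
  qed
  have "Q * (\<Sum>j\<le>Suc k. t (Suc k) j) - P * (\<Sum>j\<le>k. t k j)
      = (\<Sum>j\<le>k. Q * t (Suc k) j - P * t k j) + Q * t (Suc k) (Suc k)"
    by (simp add: sum_subtractf sum_distrib_left algebra_simps)
  also have "(\<Sum>j\<le>k. Q * t (Suc k) j - P * t k j) = (\<Sum>j\<le>k. g j - g (Suc j))"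
    using step by (intro sum.cong) auto
  also have "\<dots> = - g (Suc k)"
    by (subst sum_telescope) (simp add: g_def)
  \<comment> \<open>At r = k + 1 the factor 1 + A + k + r of \<open>g\<close> equals A + 2r, the
    factor by which \<open>t\<close> differs from \<open>v\<close> apart from 1/A.\<close>
  also have "Q * t (Suc k) (Suc k) = g (Suc k)"
  proof -
    have shift: "A - B + of_nat (Suc k) = 1 + A - B + of_nat k" "A - C + of_nat (Suc k) = 1 + A - C + of_nat k"
      "1 + A + of_nat (k + Suc k) = A + 2 * of_nat (Suc k)" "of_nat (Suc k) = 1 + (of_nat k :: 'a)"
      by simp_all
    show ?thesis
      unfolding g_def t_def Q_def shift(1-3) unfolding shift(4) by (simp only: times_divide_eq_left times_divide_eq_right mult_ac)
  qed
  finally have "Q * (\<Sum>j\<le>Suc k. t (Suc k) j) = P * (\<Sum>j\<le>k. t k j)"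
    by simp
  also have "(\<Sum>j\<le>k. t k j) = pochhammer (1 + A - B - C) k /
           (fact k * pochhammer (1 + A - B) k * pochhammer (1 + A - C) k)"
    using Suc.IH by (simp add: t_def v_def well_poised_coeff_def mult_ac)
  moreover have "Q \<noteq> 0"
    using nz(2,3)[of k] of_nat_neq_0[of k, where ?'a = 'a] by (simp add: Q_def)
  ultimately have "(\<Sum>j\<le>Suc k. t (Suc k) j) = P * (pochhammer (1 + A - B - C) k /
           (fact k * pochhammer (1 + A - B) k * pochhammer (1 + A - C) k)) / Q"
    by (simp only: nonzero_eq_divide_eq mult.commute[of _ Q] simp_thms)
  then show ?case
    by (simp add: t_def v_def well_poised_coeff_def P_def Q_def pochhammer_Suc mult_ac)
qed

text \<open>The kernel absorbs (k - r)(k + r + A) by passing from k to k - 1. Hence the weight r(r +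
  A) turns the second member q_k into k(k + A) q_k - q_(k-1), and the relation for \<open>X\<close>
  makes q_k minus \<open>X\<close> times this expression factor completely.\<close>

lemma weighted_well_poised_bailey_pair:
  fixes A B C G X :: "'a :: field_char_0"
  assumes A: "A \<noteq> 0" "1 + A \<notin> \<int>\<^sub>\<le>\<^sub>0"
    and B: "1 + A - B \<notin> \<int>\<^sub>\<le>\<^sub>0" and C: "1 + A - C \<notin> \<int>\<^sub>\<le>\<^sub>0" and G: "G \<notin> \<int>\<^sub>\<le>\<^sub>0"
    and X: "X * (G * B * C) = A - B - C - G"
  shows "(\<Sum>r\<le>k. well_poised_coeff A B C r * (1 - of_nat r * (of_nat r + A) * X) /
            (fact (k - r) * pochhammer (1 + A) (k + r))) =
         pochhammer (A - B - C) k * pochhammer (G + 1) k /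
           (pochhammer G k * fact k * pochhammer (1 + A - B) k * pochhammer (1 + A - C) k)"
proof (cases k)
  case 0
  then show ?thesis using A by (simp add: well_poised_coeff_def)
next
  case (Suc l)
  define q where "q = (\<lambda>k. pochhammer (1 + A - B - C) k /
    (fact k * pochhammer (1 + A - B) k * pochhammer (1 + A - C) k))"
  \<comment> \<open>A common factor of neighbouring values: q_k = p (A - B - C + k) and q_(k-1) = p
    k (A - B + k)(A - C + k), where l = k - 1.\<close>
  define p where "p = q l / (of_nat k * (1 + A - B + of_nat l) * (1 + A - C + of_nat l))"
  define t where "t = (\<lambda>k r. well_poised_coeff A B C r / (fact (k - r) * pochhammer (1 + A) (k + r)))"
  have sum_t: "(\<Sum>r\<le>k. t k r) = q k" for k
    unfolding t_def q_def by (rule well_poised_bailey_pair[OF A B C])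
  have nz: "1 + A + of_nat j \<noteq> 0" "1 + A - B + of_nat j \<noteq> 0" "1 + A - C + of_nat j \<noteq> 0"
    "pochhammer G j \<noteq> 0" for j
    using assms by (simp_all add: pochhammer_nonzero add_of_nat_nonzero)
  have G0: "G \<noteq> 0" using G by auto
  \<comment> \<open>Only r \<le> l is covered: at r = k the absorbed factor vanishes, whereas
    truncated subtraction need not make \<open>t l k\<close> zero.\<close>
  have lower: "of_nat r * (of_nat r + A) * t k r = of_nat k * (of_nat k + A) * t k r - t l r"
    if "r \<le> l" for r
  proof -
    obtain m where m: "l = r + m"
      using le_Suc_ex[OF \<open>r \<le> l\<close>] by blast
    have nz': "of_nat (Suc m) \<noteq> (0 :: 'a)"
      by (rule of_nat_neq_0)
    have "t k r = t l r / (of_nat (Suc m) * (1 + A + of_nat (l + r)))"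
      by (simp add: t_def Suc m Suc_diff_le pochhammer_Suc mult_ac del: of_nat_Suc of_nat_add)
    then have "t l r = t k r * of_nat (Suc m) * (1 + A + of_nat (l + r))"
      using nz' nz(1)[of "l + r"] by (simp del: of_nat_Suc of_nat_add)
    also have "\<dots> = of_nat k * (of_nat k + A) * t k r - of_nat r * (of_nat r + A) * t k r"
      by (simp add: Suc m algebra_simps)
    finally show ?thesis by simp
  qed
  have "(\<Sum>r\<le>k. of_nat r * (of_nat r + A) * t k r) =
      (\<Sum>r\<le>l. of_nat k * (of_nat k + A) * t k r - t l r) + of_nat k * (of_nat k + A) * t k k"
    using lower by (simp add: Suc)
  also have "\<dots> = of_nat k * (of_nat k + A) * q k - q l"
    by (simp add: Suc sum_subtractf flip: sum_t) (simp add: sum_distrib_left sum.distrib algebra_simps)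
  finally have weight: "(\<Sum>r\<le>k. of_nat r * (of_nat r + A) * t k r) = of_nat k * (of_nat k + A) * q k - q l" .
  have "(\<Sum>r\<le>k. well_poised_coeff A B C r * (1 - of_nat r * (of_nat r + A) * X) /
            (fact (k - r) * pochhammer (1 + A) (k + r))) =
        (\<Sum>r\<le>k. t k r - X * (of_nat r * (of_nat r + A) * t k r))"
    by (intro sum.cong refl) (simp add: t_def diff_divide_distrib[symmetric] algebra_simps)
  also have "\<dots> = q k - X * (of_nat k * (of_nat k + A) * q k - q l)"
    by (simp add: sum_subtractf sum_t flip: weight sum_distrib_left)
  also have "G * \<dots> = (A - B - C) * (G + of_nat k) * p"
  proof -
    have ql: "q l = p * (of_nat k * (1 + A - B + of_nat l) * (1 + A - C + of_nat l))"
      using nz(2,3)[of l] of_nat_neq_0[of l, where ?'a = 'a] by (simp add: p_def Suc del: of_nat_Suc)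
    have "q k = q l * (1 + A - B - C + of_nat l) / (of_nat k * (1 + A - B + of_nat l) * (1 + A - C + of_nat l))"
      by (simp add: q_def Suc pochhammer_Suc mult_ac)
    then have qk: "q k = p * (A - B - C + of_nat k)"
      by (simp add: p_def Suc algebra_simps)
    \<comment> \<open>With x = A + k, the difference x (x - B - C) - (x - B)(x - C) is -BC, so all
      higher powers of k cancel.\<close>
    have "G * (q k - X * (of_nat k * (of_nat k + A) * q k - q l)) =
        p * (G * (A - B - C + of_nat k) + of_nat k * (X * (G * B * C)))"
      unfolding qk ql by (simp add: Suc algebra_simps)
    also have "\<dots> = (A - B - C) * (G + of_nat k) * p"
      unfolding X by (simp add: algebra_simps)
    finally show ?thesis .
  qed
  also have "\<dots> = G * (pochhammer (A - B - C) k * pochhammer (G + 1) k /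
           (pochhammer G k * fact k * pochhammer (1 + A - B) k * pochhammer (1 + A - C) k))"
  proof -
    have "pochhammer G k * (G + of_nat k) = G * pochhammer (G + 1) k"
      by (metis pochhammer_Suc pochhammer_rec)
    then have "G + of_nat k = G * pochhammer (G + 1) k / pochhammer G k"
      using nz(4)[of k] by (simp add: eq_divide_eq mult.commute)
    moreover have "pochhammer (A - B - C) k = (A - B - C) * pochhammer (1 + A - B - C) l"
      by (simp add: Suc pochhammer_rec algebra_simps)
    ultimately show ?thesis
      by (simp add: p_def q_def Suc pochhammer_Suc mult_ac)
  qed
  finally show ?thesis
    by (rule mult_left_cancel[OF G0, THEN iffD1])
qed

section \<open>The Bailey transform\<close>

lemma sum_triangle_shift:
  fixes f :: "nat \<Rightarrow> nat \<Rightarrow> 'a :: comm_monoid_add"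
  shows "(\<Sum>k\<le>n. \<Sum>r\<le>k. f r k) = (\<Sum>r\<le>n. \<Sum>j\<le>n-r. f r (r + j))"
  unfolding sum.Sigma[OF finite_atMost ballI[OF finite_atMost]]
  by (rule sum.reindex_bij_witness[of _ "\<lambda>(r, j). (r + j, r)" "\<lambda>(k, r). (r, k - r)"]) auto

text \<open>Inserting the pair and interchanging the sums leaves an inner sum over j = k - r. It is
  a Saalschuetz convolution, so the sequence built from D and E has a closed-form conjugate.\<close>

lemma bailey_transform:
  fixes A D E :: "'a :: field_char_0"
  assumes A: "1 + A \<notin> \<int>\<^sub>\<le>\<^sub>0" and D: "1 + A - D \<notin> \<int>\<^sub>\<le>\<^sub>0" and E: "1 + A - E \<notin> \<int>\<^sub>\<le>\<^sub>0"
    and pair: "\<And>k. (\<Sum>r\<le>k. \<alpha> r / (fact (k - r) * pochhammer (1 + A) (k + r))) = \<beta> k"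
  shows "(\<Sum>k\<le>n. pochhammer D k * pochhammer E k * (pochhammer (1 + A - D - E) (n - k) / fact (n - k)) * \<beta> k) =
         pochhammer (1 + A - D) n * pochhammer (1 + A - E) n *
         (\<Sum>r\<le>n. \<alpha> r * pochhammer D r * pochhammer E r /
           (pochhammer (1 + A - D) r * pochhammer (1 + A - E) r * (fact (n - r) * pochhammer (1 + A) (n + r))))"
proof -
  define \<delta> where "\<delta> = (\<lambda>k. pochhammer D k * pochhammer E k *
    (pochhammer (1 + A - D - E) (n - k) / fact (n - k)))"
  have nz: "pochhammer (1 + A - D) j \<noteq> 0" "pochhammer (1 + A - E) j \<noteq> 0" for j
    using assms by (simp_all add: pochhammer_nonzero)
  have inner: "(\<Sum>j\<le>n-r. \<delta> (r + j) / (fact j * pochhammer (1 + A) (2 * r + j))) =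
      pochhammer (1 + A - D) n * pochhammer (1 + A - E) n *
      (pochhammer D r * pochhammer E r /
        (pochhammer (1 + A - D) r * pochhammer (1 + A - E) r * (fact (n - r) * pochhammer (1 + A) (n + r))))"
    if "r \<le> n" for r
  proof -
    obtain m where m: "n = r + m"
      using le_Suc_ex[OF \<open>r \<le> n\<close>] by blast
    \<comment> \<open>These shifts come from splitting the Pochhammer symbols at r and 2r. They keep
      c - a - b = 1 + A - D - E free of r, as the convolution weight requires.\<close>
    define a b c where "a = D + of_nat r" and "b = E + of_nat r" and "c = 1 + A + of_nat (2 * r)"
    have c: "c \<notin> \<int>\<^sub>\<le>\<^sub>0"
      unfolding c_def by (metis A add.assoc add.commute diff_add_cancel nonpos_Ints_diff_Nats of_nat_in_Nats
          add_diff_cancel_right')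
    have cd: "c - a = 1 + A - D + of_nat r" "c - b = 1 + A - E + of_nat r" "c - a - b = 1 + A - D - E"
      by (simp_all add: a_def b_def c_def)
    have "(\<Sum>j\<le>n-r. \<delta> (r + j) / (fact j * pochhammer (1 + A) (2 * r + j))) =
        pochhammer D r * pochhammer E r / pochhammer (1 + A) (2 * r) *
        (\<Sum>j\<le>m. pochhammer a j * pochhammer b j / (fact j * pochhammer c j) *
            (pochhammer (c - a - b) (m - j) / fact (m - j)))"
      unfolding cd(3) by (simp add: \<delta>_def m sum_distrib_left pochhammer_product' a_def b_def c_def mult_ac)
    also have "\<dots> = pochhammer D r * pochhammer E r / pochhammer (1 + A) (2 * r) *
        (pochhammer (c - a) m * pochhammer (c - b) m / (fact m * pochhammer c m))"
      by (simp only: saalschuetz[OF c])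
    also have "\<dots> = pochhammer (1 + A - D) n * pochhammer (1 + A - E) n *
      (pochhammer D r * pochhammer E r /
        (pochhammer (1 + A - D) r * pochhammer (1 + A - E) r *
          (fact m * (pochhammer (1 + A) (2 * r) * pochhammer c m))))"
      unfolding cd(1,2) m pochhammer_product' using nz[of r] by simp (simp add: mult_ac)
    also have "pochhammer (1 + A) (2 * r) * pochhammer c m = pochhammer (1 + A) (n + r)"
      unfolding c_def pochhammer_product'[symmetric] by (simp add: m mult_2 add_ac)
    finally show ?thesis by (simp add: m)
  qed
  have idx: "r + j + r = 2 * r + j" for r j :: nat
    by simp
  have "(\<Sum>k\<le>n. \<delta> k * \<beta> k) =
      (\<Sum>k\<le>n. \<Sum>r\<le>k. \<delta> k * (\<alpha> r / (fact (k - r) * pochhammer (1 + A) (k + r))))"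
    by (simp add: sum_distrib_left flip: pair)
  also have "\<dots> = (\<Sum>r\<le>n. \<Sum>j\<le>n-r. \<alpha> r * (\<delta> (r + j) / (fact j * pochhammer (1 + A) (2 * r + j))))"
    by (subst sum_triangle_shift) (simp add: idx mult.commute[of "\<alpha> _"])
  also have "\<dots> = (\<Sum>r\<le>n. \<alpha> r * (pochhammer (1 + A - D) n * pochhammer (1 + A - E) n *
      (pochhammer D r * pochhammer E r /
        (pochhammer (1 + A - D) r * pochhammer (1 + A - E) r * (fact (n - r) * pochhammer (1 + A) (n + r))))))"
    by (intro sum.cong refl) (simp only: sum_distrib_left[symmetric] inner atMost_iff)
  finally show ?thesis
    by (simp add: \<delta>_def sum_distrib_left mult_ac)
qed

section \<open>Reversal of Pochhammer symbols and terminating series\<close>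

text \<open>The last k factors of (s)_n, read backwards and negated, are those of (1 - s - n)_k. The
  case s = 1 gives (-n)_k.\<close>

lemma pochhammer_reverse:
  fixes s :: "'a :: field_char_0"
  assumes "k \<le> n"
  shows "pochhammer (1 - s - of_nat n) k * pochhammer s (n - k) = (-1) ^ k * pochhammer s n"
proof -
  have "1 - s - of_nat n = - (s + of_nat n - 1)"
    and "s + of_nat (n - k) = s + of_nat n - 1 - of_nat k + 1"
    using assms by simp_all
  then have "pochhammer (1 - s - of_nat n) k = (-1) ^ k * pochhammer (s + of_nat (n - k)) k"
    by (simp only: pochhammer_minus)
  moreover have "pochhammer s n = pochhammer s (n - k) * pochhammer (s + of_nat (n - k)) k"
    using pochhammer_product[of "n - k" n s] assms by simp
  ultimately show ?thesis
    by (simp add: algebra_simps)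
qed

lemma pochhammer_minus_of_nat:
  assumes "k \<le> n"
  shows "pochhammer (- of_nat n :: 'a :: field_char_0) k = (-1) ^ k * fact n / fact (n - k)"
  using pochhammer_reverse[OF assms, of "1 :: 'a"] by (simp add: pochhammer_fact[symmetric] eq_divide_eq)

text \<open>Collapses each pair of parameters z + 1 over z, as for A/2 and A/2 \<plusminus> \<omega>
  in the \<open>9F8\<close>.\<close>

lemma pochhammer_plus1_quotient:
  fixes z :: "'a :: field_char_0"
  assumes "z \<notin> \<int>\<^sub>\<le>\<^sub>0"
  shows "pochhammer (z + 1) n = pochhammer z n * ((z + of_nat n) / z)"
proof -
  have "z \<noteq> 0"
    using assms by auto
  moreover have "pochhammer z n * (z + of_nat n) = z * pochhammer (z + 1) n"
    by (metis pochhammer_Suc pochhammer_rec)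
  ultimately show ?thesis
    by (simp add: eq_divide_eq mult_ac)
qed

text \<open>Beyond index n the factor (-n)_k is zero, so the infinite series is a finite
  sum.\<close>

lemma hypergeo_unit_terminating:
  assumes "- of_nat n \<in> set as"
  shows "hypergeo_unit as bs =
    (\<Sum>k\<le>n. prod_list (map (\<lambda>a. pochhammer a k) as) /
      (prod_list (map (\<lambda>b. pochhammer b k) bs) * fact k))"
proof -
  have "prod_list (map (\<lambda>a. pochhammer a k) as) = 0" if "k > n" for k
    using assms that by (auto simp: prod_list_zero_iff pochhammer_of_nat_eq_0_iff intro!: rev_image_eqI)
  then show ?thesis
    unfolding hypergeo_unit_eq_suminf by (intro suminf_finite) auto
qed

section \<open>Both hypergeometric series as the two sides of the Bailey transform\<close>

theorem mainTheorem15: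
  fixes A B C D E F G \<omega> :: complex and m :: int
  assumes F_neg_int: "F = of_int m" "m < 0"
    and omega_denom: "A - B - C - G \<noteq> 0"
    and omega: "\<omega>\<^sup>2 = G * B * C / (A - B - C - G) + A\<^sup>2 / 4"
    and lower_5F4: "\<forall>b \<in> {1 + A - B, 1 + A - C, D + E + F - A, G}. b \<notin> \<int>\<^sub>\<le>\<^sub>0"
    and lower_9F8: "\<forall>b \<in> {A/2, 1 + A - B, 1 + A - C, 1 + A - D, 1 + A - E, 1 + A - F,
                        A/2 - \<omega>, A/2 + \<omega>}. b \<notin> \<int>\<^sub>\<le>\<^sub>0"
    and Gamma_args: "\<forall>z \<in> {A + 1, 1 + A - D - F, 1 + A - E - F, 1 + A - D - E,
                         1 + A - F, 1 + A - D, 1 + A - E, 1 + A - D - E - F}. z \<notin> \<int>\<^sub>\<le>\<^sub>0"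
  shows "hypergeo_unit
           [A - B - C, D, E, F, G + 1]
           [1 + A - B, 1 + A - C, D + E + F - A, G] =
         (Gamma (A + 1) * Gamma (1 + A - D - F) * Gamma (1 + A - E - F) * Gamma (1 + A - D - E)) /
         (Gamma (1 + A - F) * Gamma (1 + A - D) * Gamma (1 + A - E) * Gamma (1 + A - D - E - F)) *
         hypergeo_unit
           [A, 1 + A/2, B, C, D, E, F, A/2 - \<omega> + 1, A/2 + \<omega> + 1]
           [A/2, 1 + A - B, 1 + A - C, 1 + A - D, 1 + A - E, 1 + A - F, A/2 - \<omega>, A/2 + \<omega>]"
proof -
  define n where "n = nat (- m)"
  have F: "F = - of_nat n"
    using F_neg_int by (simp add: n_def)
  define s where "s = 1 + A - D - E"
  \<comment> \<open>-1/X is the product of the lower parameters A/2 - \<omega> and A/2 + \<omega>,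
    hence nonzero; the equation for \<omega> turns this into the relation the weighted pair
    requires.\<close>
  define X where "X = 1 / (\<omega>\<^sup>2 - A\<^sup>2 / 4)"
  have half: "A / 2 \<notin> \<int>\<^sub>\<le>\<^sub>0" "A / 2 - \<omega> \<notin> \<int>\<^sub>\<le>\<^sub>0" "A / 2 + \<omega> \<notin> \<int>\<^sub>\<le>\<^sub>0"
    using lower_9F8 by simp_all
  have B: "1 + A - B \<notin> \<int>\<^sub>\<le>\<^sub>0" and C: "1 + A - C \<notin> \<int>\<^sub>\<le>\<^sub>0" and G: "G \<notin> \<int>\<^sub>\<le>\<^sub>0"
    using lower_5F4 by simp_all
  have A: "1 + A \<notin> \<int>\<^sub>\<le>\<^sub>0" and D: "1 + A - D \<notin> \<int>\<^sub>\<le>\<^sub>0" and E: "1 + A - E \<notin> \<int>\<^sub>\<le>\<^sub>0"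
    and s: "s \<notin> \<int>\<^sub>\<le>\<^sub>0"
    using Gamma_args by (simp_all add: s_def add.commute)
  have A0: "A \<noteq> 0"
    using half(1) by auto
  have "A / 2 - \<omega> \<noteq> 0" "A / 2 + \<omega> \<noteq> 0"
    using half by auto
  moreover have "(A / 2 - \<omega>) * (A / 2 + \<omega>) = - (\<omega>\<^sup>2 - A\<^sup>2 / 4)"
    by (simp add: power2_eq_square algebra_simps)
  ultimately have W: "\<omega>\<^sup>2 - A\<^sup>2 / 4 \<noteq> 0"
    by (metis mult_eq_0_iff neg_equal_0_iff_equal)
  have "(\<omega>\<^sup>2 - A\<^sup>2 / 4) * (A - B - C - G) = G * B * C"
    using omega omega_denom by simp
  then have X: "X * (G * B * C) = A - B - C - G"
    using W by (simp add: X_def divide_eq_eq mult.commute)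
  define \<alpha> where "\<alpha> = (\<lambda>r. well_poised_coeff A B C r * (1 - of_nat r * (of_nat r + A) * X))"
  define \<beta> where "\<beta> = (\<lambda>k. pochhammer (A - B - C) k * pochhammer (G + 1) k /
           (pochhammer G k * fact k * pochhammer (1 + A - B) k * pochhammer (1 + A - C) k))"
  have transform: "(\<Sum>k\<le>n. pochhammer D k * pochhammer E k * (pochhammer s (n - k) / fact (n - k)) * \<beta> k) =
         pochhammer (1 + A - D) n * pochhammer (1 + A - E) n *
         (\<Sum>r\<le>n. \<alpha> r * pochhammer D r * pochhammer E r /
           (pochhammer (1 + A - D) r * pochhammer (1 + A - E) r * (fact (n - r) * pochhammer (1 + A) (n + r))))"
    (is "_ = _ * ?S")
    unfolding s_def \<alpha>_def \<beta>_def
    by (rule bailey_transform[OF A D E weighted_well_poised_bailey_pair[OF A0 A B C G X]])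
  have nz: "pochhammer s k \<noteq> 0" "pochhammer (1 + A) k \<noteq> 0" for k
    using s A by (simp_all add: pochhammer_nonzero)
  have left: "hypergeo_unit [A - B - C, D, E, F, G + 1] [1 + A - B, 1 + A - C, D + E + F - A, G] =
      fact n / pochhammer s n *
      (\<Sum>k\<le>n. pochhammer D k * pochhammer E k * (pochhammer s (n - k) / fact (n - k)) * \<beta> k)"
  proof -
    have ratio: "pochhammer F k / pochhammer (D + E + F - A) k =
        fact n / pochhammer s n * (pochhammer s (n - k) / fact (n - k))" if "k \<le> n" for k
    proof -
      \<comment> \<open>The lower parameter D + E + F - A is thus the reversal of s, and its sign
        (-1)^k cancels that of (F)_k.\<close>
      have "1 - s - of_nat n = D + E + F - A"
        by (simp add: s_def F)
      then have "pochhammer (D + E + F - A) k = (-1) ^ k * pochhammer s n / pochhammer s (n - k)"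
        using pochhammer_reverse[OF that, of s] nz(1)[of "n - k"] by (simp add: eq_divide_eq)
      then show ?thesis
        by (simp add: F pochhammer_minus_of_nat[OF that])
    qed
    have "hypergeo_unit [A - B - C, D, E, F, G + 1] [1 + A - B, 1 + A - C, D + E + F - A, G] =
        (\<Sum>k\<le>n. pochhammer D k * pochhammer E k * (pochhammer F k / pochhammer (D + E + F - A) k) * \<beta> k)"
      by (subst hypergeo_unit_terminating[of n]) (simp_all add: F \<beta>_def mult_ac)
    also have "\<dots> = (\<Sum>k\<le>n. fact n / pochhammer s n *
        (pochhammer D k * pochhammer E k * (pochhammer s (n - k) / fact (n - k)) * \<beta> k))"
      by (intro sum.cong refl) (simp add: ratio mult_ac)
    finally show ?thesis
      by (simp only: sum_distrib_left)
  qed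
  have right: "hypergeo_unit
           [A, 1 + A/2, B, C, D, E, F, A/2 - \<omega> + 1, A/2 + \<omega> + 1]
           [A/2, 1 + A - B, 1 + A - C, 1 + A - D, 1 + A - E, 1 + A - F, A/2 - \<omega>, A/2 + \<omega>] =
      fact n * pochhammer (1 + A) n * ?S"
  proof -
    have very_well_poised: "pochhammer (1 + A / 2) r / pochhammer (A / 2) r = (A + 2 * of_nat r) / A" for r
    proof -
      have "(A / 2 + of_nat r) / (A / 2) = (A + 2 * of_nat r) / A"
        using A0 by (simp add: field_simps)
      then show ?thesis
        using pochhammer_nonzero[OF half(1), of r]
        by (simp only: add.commute[of 1 "A / 2"] pochhammer_plus1_quotient[OF half(1)]
            nonzero_mult_div_cancel_left not_False_eq_True)
    qed
    \<comment> \<open>Both pairs collapse, and (A/2 - \<omega> + r)(A/2 + \<omega> + r) exceeds its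
      value at r = 0 by r(r + A).\<close>
    have weight: "pochhammer (A/2 - \<omega> + 1) r * pochhammer (A/2 + \<omega> + 1) r /
        (pochhammer (A/2 - \<omega>) r * pochhammer (A/2 + \<omega>) r) = 1 - of_nat r * (of_nat r + A) * X" for r
    proof -
      have "pochhammer (A/2 - \<omega> + 1) r * pochhammer (A/2 + \<omega> + 1) r /
          (pochhammer (A/2 - \<omega>) r * pochhammer (A/2 + \<omega>) r) =
          ((A/2 - \<omega> + of_nat r) * (A/2 + \<omega> + of_nat r)) / ((A/2 - \<omega>) * (A/2 + \<omega>))"
        using pochhammer_nonzero[OF half(2), of r] pochhammer_nonzero[OF half(3), of r]
        by (simp add: pochhammer_plus1_quotient half)
      also have "(A/2 - \<omega>) * (A/2 + \<omega>) = - (\<omega>\<^sup>2 - A\<^sup>2 / 4)"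
        by (simp add: power2_eq_square algebra_simps)
      also have "(A/2 - \<omega> + of_nat r) * (A/2 + \<omega> + of_nat r) =
          - (\<omega>\<^sup>2 - A\<^sup>2 / 4) + of_nat r * (of_nat r + A)"
        by (simp add: power2_eq_square algebra_simps)
      also have "\<dots> / - (\<omega>\<^sup>2 - A\<^sup>2 / 4) = 1 - of_nat r * (of_nat r + A) * X"
      proof -
        have "(- w + p) / - w = 1 - p * (1 / w)" if "w \<noteq> 0" for w p :: complex
          using that by (simp add: field_simps)
        with W show ?thesis
          unfolding X_def by blast
      qed
      finally show ?thesis .
    qed
    \<comment> \<open>Since 1 + A - F = 1 + A + n, splitting (1 + A)_(n+r) at n produces the Bailey
      kernel, with n playing the role of k.\<close>
    have ratio: "(-1) ^ r * (pochhammer F r / pochhammer (1 + A - F) r) =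
        fact n * pochhammer (1 + A) n / (fact (n - r) * pochhammer (1 + A) (n + r))" if "r \<le> n" for r
      using nz(2)[of n] by (simp add: F pochhammer_minus_of_nat[OF that] pochhammer_product')
    have "hypergeo_unit
           [A, 1 + A/2, B, C, D, E, F, A/2 - \<omega> + 1, A/2 + \<omega> + 1]
           [A/2, 1 + A - B, 1 + A - C, 1 + A - D, 1 + A - E, 1 + A - F, A/2 - \<omega>, A/2 + \<omega>] =
        (\<Sum>r\<le>n. pochhammer (1 + A / 2) r / pochhammer (A / 2) r *
          (pochhammer (A/2 - \<omega> + 1) r * pochhammer (A/2 + \<omega> + 1) r /
            (pochhammer (A/2 - \<omega>) r * pochhammer (A/2 + \<omega>) r)) *
          (pochhammer F r / pochhammer (1 + A - F) r) *
          (pochhammer A r * pochhammer B r * pochhammer C r * pochhammer D r * pochhammer E r /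
            (fact r * pochhammer (1 + A - B) r * pochhammer (1 + A - C) r *
              pochhammer (1 + A - D) r * pochhammer (1 + A - E) r)))"
      by (subst hypergeo_unit_terminating[of n]) (simp_all add: F mult_ac)
    also have "\<dots> = (\<Sum>r\<le>n. (-1) ^ r * (pochhammer F r / pochhammer (1 + A - F) r) *
        (\<alpha> r * pochhammer D r * pochhammer E r / (pochhammer (1 + A - D) r * pochhammer (1 + A - E) r)))"
      unfolding very_well_poised weight by (simp add: \<alpha>_def well_poised_coeff_def mult_ac)
    also have "\<dots> = (\<Sum>r\<le>n. fact n * pochhammer (1 + A) n * (\<alpha> r * pochhammer D r * pochhammer E r /
           (pochhammer (1 + A - D) r * pochhammer (1 + A - E) r * (fact (n - r) * pochhammer (1 + A) (n + r)))))"
      by (intro sum.cong refl) (simp only: ratio atMost_iff, simp add: mult_ac)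
    finally show ?thesis
      by (simp only: sum_distrib_left)
  qed
  \<comment> \<open>As -F = n, the eight Gamma values pair into four quotients with arguments
    differing by n, each a Pochhammer symbol or its reciprocal.\<close>
  have Gamma_shift: "Gamma (z + of_nat n) = pochhammer z n * Gamma z" if "z \<notin> \<int>\<^sub>\<le>\<^sub>0" for z :: complex
    using that by (simp add: pochhammer_Gamma Gamma_eq_zero_iff)
  have "(Gamma (A + 1) * Gamma (1 + A - D - F) * Gamma (1 + A - E - F) * Gamma (1 + A - D - E)) /
      (Gamma (1 + A - F) * Gamma (1 + A - D) * Gamma (1 + A - E) * Gamma (1 + A - D - E - F)) =
      pochhammer (1 + A - D) n * pochhammer (1 + A - E) n / (pochhammer (1 + A) n * pochhammer s n)"
    using Gamma_shift[OF A] Gamma_shift[OF D] Gamma_shift[OF E] Gamma_shift[OF s] A D E s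
    by (simp add: F s_def[symmetric] add.commute[of A 1] Gamma_eq_zero_iff)
  then show ?thesis
    unfolding left right transform using nz[of n] by simp
qed

end
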